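(* Assume there exists a feasible point $M$ of the problem (P) described in the context such that $(M_t)_{ij}>0$ whenever $(A_t)_{ij}>0$ (for all $t,i,j$). Let $M^*$ be an optimal solution of (P). Let $\lambda_0,\dots,\lambda_T$ be an optimal solution of the dual problem (D) in the context, $u_t:=\exp(C^\top\lambda_t)$, and define $w_0:=\mathbf 1$, $w_T:=u_T$, and $w_t:=u_t\odot(A_tw_{t+1})$ for $t=T-1,\dots,1$. Set $$\mathcal A_t:=\operatorname{diag}(u_t\oslash w_t)\,A_t\,\operatorname{diag}(w_{t+1}),\qquad t=0,\dots,T-1.$$ Then any other optimal solution $\tilde M$ of (P) can be written as $$\tilde M_t=M_t^*+\operatorname{diag}(z_t)\mathcal A_t,\qquad z_{t+1}=\mathcal A_t^\top z_t,\qquad t=0,\dots,T-1,$$ for a sequence $z_0,\dots,z_T\in\mathbb{R}^n$ satisfying $z_0\in\ker(\mathcal O_{T+1})$ and $M_0^*\mathbf 1+z_0\ge0$, where $$\mathcal O_{T+1}=\begin{bmatrix}C\\ CA_0^\top\\ CA_1^\top A_0^\top\\ \vdots\\ CA_{T-1}^\top\cdots A_0^\top\end{bmatrix}.$$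
   Context: Setting. Let $n,T\ge1$ be integers and let $A_0,\dots,A_{T-1}\in\mathbb{R}^{n\times n}_{\ge0}$ be row-stochastic matrices ($A_t\mathbf 1=\mathbf 1$). Let $\pi=\{\pi_1,\dots,\pi_k\}\subseteq\{1,\dots,n\}$ have $k$ elements and let $C=[e_{\pi_1},\dots,e_{\pi_k}]^\top\in\{0,1\}^{k\times n}$ be the coordinate-selection matrix of $\pi$. Let $\rho_0,\dots,\rho_T\in\mathbb{R}^k$ be given. Notation. $\mathbf 1$ is the all-ones vector; $\odot,\oslash,\exp$ are entrywise; vector inequalities are entrywise; $\operatorname{supp}$ is the set of positions of nonzero entries. For nonnegative arrays $p,q$ of the same size with $\operatorname{supp}(p)\subseteq\operatorname{supp}(q)$, $\mathcal D(p\,|\,q)=\sum_i\big(p_i\log(p_i/q_i)-p_i+q_i\big)$, with $0\log 0:=0$ (terms with $p_i=q_i=0$ are $0$). Problem (P): minimize $\sum_{t=0}^{T-1}\mathcal D\big(M_t\,|\,\operatorname{diag}(M_t\mathbf 1)A_t\big)$ over $M_0,\dots,M_{T-1}\in\mathbb{R}^{n\times n}_{\ge0}$ with $\operatorname{supp}(M_t)\subseteq\operatorname{supp}(A_t)$, subject to (i) $CM_t\mathbf 1=\rho_t$ for $t=0,\dots,T-1$; (ii) $CM_{T-1}^\top\mathbf 1=\rho_T$; (iii) $M_t\mathbf 1=M_{t-1}^\top\mathbf 1$ for $t=1,\dots,T-1$. Dual problem (D): maximize $\sum_{t=0}^T\lambda_t^\top\rho_t$ over $\lambda_0,\dots,\lambda_T\in\mathbb{R}^k$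 subject to $\operatorname{diag}(u_0)A_0\operatorname{diag}(u_1)A_1\cdots\operatorname{diag}(u_{T-1})A_{T-1}u_T\le\mathbf 1$, where $u_t=\exp(C^\top\lambda_t)$. *)

theory Defs
  imports "HOL-Analysis.Analysis"
begin

text \<open>
  Conventions: \<open>\<real>\<^sup>n\<close> is \<open>real ^ 'n\<close> and \<open>\<real>\<^sup>k\<close> is \<open>real ^ 'k\<close> for finite index types; on these types
  \<open>1\<close> is the all-ones vector, \<open>0\<close> the zero vector, \<open>*\<close> the entrywise product and \<open>\<le>\<close> the entrywise
  order.  Finite sequences are functions on \<open>nat\<close> of which only the entries with index \<open>< T\<close>
  (for matrices) or \<open>\<le> T\<close> (for vectors) are ever referred to.
\<close>

definition diag_mat :: "real ^ 'n \<Rightarrow> real ^ 'n ^ 'n" where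
  "diag_mat v = (\<chi> i j. if i = j then v $ i else 0)"

definition exp_vec :: "real ^ 'n \<Rightarrow> real ^ 'n" where
  "exp_vec v = (\<chi> i. exp (v $ i))"

definition div_vec :: "real ^ 'n \<Rightarrow> real ^ 'n \<Rightarrow> real ^ 'n" where
  "div_vec v w = (\<chi> i. v $ i / w $ i)"

definition nonneg_mat :: "real ^ 'n ^ 'm \<Rightarrow> bool" where
  "nonneg_mat M \<longleftrightarrow> (\<forall>i j. 0 \<le> M $ i $ j)"

definition supp_mat :: "real ^ 'n ^ 'm \<Rightarrow> ('m \<times> 'n) set" where
  "supp_mat M = {(i, j). M $ i $ j \<noteq> 0}"

definition row_stochastic :: "real ^ 'n ^ 'n \<Rightarrow> bool" where
  "row_stochastic A \<longleftrightarrow> nonneg_mat A \<and> A *v 1 = 1"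

text \<open>The enumeration \<open>p\<close> of the selected coordinates is injective wherever this is used.\<close>

definition selection_mat :: "('k \<Rightarrow> 'n) \<Rightarrow> real ^ 'n ^ 'k" where
  "selection_mat p = (\<chi> a. axis (p a) 1)"

text \<open>
  The divergence is meaningful for nonnegative \<open>P\<close>, \<open>Q\<close> with \<open>supp_mat P \<subseteq> supp_mat Q\<close>, which
  feasibility below guarantees for its only use; then \<open>P $ i $ j = 0\<close> is the only
  case involving a logarithm of zero or a division by zero, and the corresponding summand is
  \<open>Q $ i $ j\<close>, in accordance with \<open>0 log 0 = 0\<close>.
\<close>

definition divergence :: "real ^ 'n ^ 'm \<Rightarrow> real ^ 'n ^ 'm \<Rightarrow> real" where
  "divergence P Q =
     (\<Sum>i\<in>UNIV. \<Sum>j\<in>UNIV. P $ i $ j * ln (P $ i $ j / Q $ i $ j) - P $ i $ j + Q $ i $ j)"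

definition primal_objective ::
  "nat \<Rightarrow> (nat \<Rightarrow> real ^ 'n ^ 'n) \<Rightarrow> (nat \<Rightarrow> real ^ 'n ^ 'n) \<Rightarrow> real" where
  "primal_objective T A M = (\<Sum>t<T. divergence (M t) (diag_mat (M t *v 1) ** A t))"

definition primal_feasible ::
  "nat \<Rightarrow> (nat \<Rightarrow> real ^ 'n ^ 'n) \<Rightarrow> real ^ 'n ^ 'k \<Rightarrow> (nat \<Rightarrow> real ^ 'k) \<Rightarrow>
   (nat \<Rightarrow> real ^ 'n ^ 'n) \<Rightarrow> bool" where
  "primal_feasible T A C \<rho> M \<longleftrightarrow>
     (\<forall>t<T. nonneg_mat (M t) \<and> supp_mat (M t) \<subseteq> supp_mat (A t)) \<and>
     (\<forall>t<T. C *v (M t *v 1) = \<rho> t) \<and>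
     C *v (transpose (M (T - 1)) *v 1) = \<rho> T \<and>
     (\<forall>t\<in>{1..<T}. M t *v 1 = transpose (M (t - 1)) *v 1)"

definition primal_optimal ::
  "nat \<Rightarrow> (nat \<Rightarrow> real ^ 'n ^ 'n) \<Rightarrow> real ^ 'n ^ 'k \<Rightarrow> (nat \<Rightarrow> real ^ 'k) \<Rightarrow>
   (nat \<Rightarrow> real ^ 'n ^ 'n) \<Rightarrow> bool" where
  "primal_optimal T A C \<rho> M \<longleftrightarrow>
     primal_feasible T A C \<rho> M \<and>
     (\<forall>N. primal_feasible T A C \<rho> N \<longrightarrow> primal_objective T A M \<le> primal_objective T A N)"

definition dual_scaling :: "real ^ 'n ^ 'k \<Rightarrow> (nat \<Rightarrow> real ^ 'k) \<Rightarrow> nat \<Rightarrow> real ^ 'n" where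
  "dual_scaling C lam t = exp_vec (transpose C *v lam t)"

text \<open>\<open>scaled_chain A u t = diag(u\<^sub>0) A\<^sub>0 diag(u\<^sub>1) A\<^sub>1 \<dots> diag(u\<^sub>t\<^sub>-\<^sub>1) A\<^sub>t\<^sub>-\<^sub>1\<close>.\<close>

primrec scaled_chain ::
  "(nat \<Rightarrow> real ^ 'n ^ 'n) \<Rightarrow> (nat \<Rightarrow> real ^ 'n) \<Rightarrow> nat \<Rightarrow> real ^ 'n ^ 'n" where
  "scaled_chain A u 0 = mat 1"
| "scaled_chain A u (Suc t) = scaled_chain A u t ** diag_mat (u t) ** A t"

definition dual_feasible ::
  "nat \<Rightarrow> (nat \<Rightarrow> real ^ 'n ^ 'n) \<Rightarrow> real ^ 'n ^ 'k \<Rightarrow> (nat \<Rightarrow> real ^ 'k) \<Rightarrow> bool" where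
  "dual_feasible T A C lam \<longleftrightarrow>
     scaled_chain A (dual_scaling C lam) T *v dual_scaling C lam T \<le> 1"

definition dual_objective :: "nat \<Rightarrow> (nat \<Rightarrow> real ^ 'k) \<Rightarrow> (nat \<Rightarrow> real ^ 'k) \<Rightarrow> real" where
  "dual_objective T \<rho> lam = (\<Sum>t\<le>T. lam t \<bullet> \<rho> t)"

definition dual_optimal ::
  "nat \<Rightarrow> (nat \<Rightarrow> real ^ 'n ^ 'n) \<Rightarrow> real ^ 'n ^ 'k \<Rightarrow> (nat \<Rightarrow> real ^ 'k) \<Rightarrow>
   (nat \<Rightarrow> real ^ 'k) \<Rightarrow> bool" where
  "dual_optimal T A C \<rho> lam \<longleftrightarrow>
     dual_feasible T A C lam \<and>
     (\<forall>\<nu>. dual_feasible T A C \<nu> \<longrightarrow> dual_objective T \<rho> \<nu> \<le> dual_objective T \<rho> lam)"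

text \<open>\<open>observability_block A C t = C A\<^sub>t\<^sub>-\<^sub>1\<^sup>T \<dots> A\<^sub>0\<^sup>T\<close>, the block of row index \<open>t\<close> of the
  observability matrix.  Since \<open>T\<close> is a term, the blocks \<open>0, \<dots>, T\<close> are not stacked into a
  matrix type; the kernel of the stacked matrix is the common kernel of its blocks.\<close>

primrec transposed_chain :: "(nat \<Rightarrow> real ^ 'n ^ 'n) \<Rightarrow> nat \<Rightarrow> real ^ 'n ^ 'n" where
  "transposed_chain A 0 = mat 1"
| "transposed_chain A (Suc t) = transpose (A t) ** transposed_chain A t"

definition observability_block ::
  "(nat \<Rightarrow> real ^ 'n ^ 'n) \<Rightarrow> real ^ 'n ^ 'k \<Rightarrow> nat \<Rightarrow> real ^ 'n ^ 'k" where
  "observability_block A C t = C ** transposed_chain A t"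

definition observability_kernel ::
  "nat \<Rightarrow> (nat \<Rightarrow> real ^ 'n ^ 'n) \<Rightarrow> real ^ 'n ^ 'k \<Rightarrow> (real ^ 'n) set" where
  "observability_kernel T A C = {x. \<forall>t\<le>T. observability_block A C t *v x = 0}"

definition tilted_mat ::
  "(nat \<Rightarrow> real ^ 'n ^ 'n) \<Rightarrow> (nat \<Rightarrow> real ^ 'n) \<Rightarrow> (nat \<Rightarrow> real ^ 'n) \<Rightarrow> nat \<Rightarrow> real ^ 'n ^ 'n" where
  "tilted_mat A u w t = diag_mat (div_vec (u t) (w t)) ** A t ** diag_mat (w (t + 1))"

end

(*
  Let W be the backward messages W_T = u_T, W_t = u_t . (A_t W_{t+1}) and tilt each A_t by
  diag(u_t / W_t) and diag(W_{t+1}) to a stochastic matrix P_t.  The logarithms of the tilts telescope,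
  so for feasible M and dual feasible lambda the duality gap is the sum of the divergences of M_t from
  diag(M_t 1) P_t plus the nonnegative term - <M_0 1, ln W_0>.  Multipliers of an optimal dual solution,
  obtained by separating the first order variations from an orthant, are the initial marginal of
  a feasible chain with transitions P_t whose gap is zero.  Hence every optimal solution has gap zero
  and is determined by its marginals, M_t = diag(M_t 1) A'_t, where A'_0 agrees with P_0 on the rows
  with W_0 = 1 that carry mass.  The difference z_t of the marginals of two optimal solutions vanishes
  on the selected states, and u_t = 1 off them, so z_t / w_t evolves by the transposes of the untilted A_t.
*)

theory Submission
  imports Defs
begin

declare transpose_matrix_vector [simp del]

section \<open>Entrywise formulas for diagonal, tilted, stochastic and selection matrices\<close>

lemma diag_mat_mult_nth: "(diag_mat v ** B) $ i $ j = v $ i * B $ i $ j"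
  by (simp add: diag_mat_def matrix_matrix_mult_def if_distrib[of "\<lambda>x. x * _"] cong: if_cong)

lemma mult_diag_mat_nth: "(B ** diag_mat v) $ i $ j = B $ i $ j * v $ j"
  by (simp add: diag_mat_def matrix_matrix_mult_def if_distrib[of "\<lambda>x. _ * x"] cong: if_cong)

lemma diag_mat_mult_vec: "diag_mat v *v x = v * x"
  by (simp add: vec_eq_iff diag_mat_def matrix_vector_mult_def if_distrib[of "\<lambda>x. x * _"] cong: if_cong)

lemma tilted_mat_nth:
  "tilted_mat A u w t $ i $ j = u t $ i / w t $ i * A t $ i $ j * w (Suc t) $ j"
  by (simp add: tilted_mat_def diag_mat_mult_nth mult_diag_mat_nth div_vec_def)

lemma matrix_vector_mult_nth: "(B *v x) $ i = (\<Sum>j\<in>UNIV. B $ i $ j * x $ j)"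
  by (simp add: matrix_vector_mult_def)

lemma inner_transpose_mult: "(x::real ^ 'm) \<bullet> (transpose B *v y) = (B *v x) \<bullet> y"
  by (metis dot_lmul_matrix inner_commute transpose_matrix_vector transpose_transpose)

lemma row_stochasticD:
  assumes "row_stochastic B"
  shows "0 \<le> B $ i $ j" and "(\<Sum>j\<in>UNIV. B $ i $ j) = 1"
  using assms by (auto simp: row_stochastic_def nonneg_mat_def vec_eq_iff matrix_vector_mult_nth)

lemma row_stochastic_mult_pos:
  assumes "row_stochastic B" and "\<And>j. 0 < x $ j"
  shows "0 < (B *v x) $ i"
proof -
  have "(\<Sum>j\<in>UNIV. B $ i $ j) \<noteq> 0"
    using row_stochasticD(2)[OF assms(1)] by simp
  then obtain j where "B $ i $ j \<noteq> 0"
    by (metis sum.neutral)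
  then show ?thesis
    unfolding matrix_vector_mult_nth
    using row_stochasticD(1)[OF assms(1), of i] assms(2)
    by (intro sum_pos2[of UNIV j]) (auto simp: less_imp_le less_le zero_less_mult_iff)
qed

lemma selection_mat_mult_nth: "(selection_mat p *v x) $ a = x $ p a"
  by (simp add: selection_mat_def matrix_vector_mult_nth axis_def if_distrib[of "\<lambda>x. x * _"] cong: if_cong)

lemma transpose_selection_mat_mult_nth:
  "(transpose (selection_mat p) *v x) $ i = (\<Sum>a | p a = i. x $ a)"
  by (simp add: selection_mat_def transpose_def matrix_vector_mult_nth axis_def sum.If_cases
      if_distrib[of "\<lambda>x. x * _"] eq_commute[of i] cong: if_cong)

lemma exp_vec_0: "exp_vec 0 = 1"
  by (simp add: exp_vec_def vec_eq_iff)

lemma exp_vec_nth [simp]: "exp_vec v $ i = exp (v $ i)"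
  by (simp add: exp_vec_def)

section \<open>Backward messages, their first variation, and the adjoint forward flow\<close>

text \<open>The recursion descends from \<open>T\<close>, hence a fold over \<open>[t..<T]\<close>.
  It also covers index 0, where the theorem puts \<open>w 0 = 1\<close>; the value there is the
  left-hand side of the dual constraint.\<close>

definition message :: "nat \<Rightarrow> (nat \<Rightarrow> real ^ 'n ^ 'n) \<Rightarrow> (nat \<Rightarrow> real ^ 'n) \<Rightarrow> nat \<Rightarrow> real ^ 'n" where
  "message T A u t = foldr (\<lambda>s v. u s * (A s *v v)) [t..<T] (u T)"

lemma message_end [simp]: "message T A u T = u T"
  by (simp add: message_def)

lemma message_step: "t < T \<Longrightarrow> message T A u t = u t * (A t *v message T A u (Suc t))"
  by (simp add: message_def upt_conv_Cons)

text \<open>\<open>response\<close> is the logarithmic derivative of \<open>message\<close> when \<open>u\<close> is multiplied by \<open>exp (s \<delta>)\<close>.\<close>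

definition response :: "nat \<Rightarrow> (nat \<Rightarrow> real ^ 'n ^ 'n) \<Rightarrow> (nat \<Rightarrow> real ^ 'n) \<Rightarrow> nat \<Rightarrow> real ^ 'n" where
  "response T P \<delta> t = foldr (\<lambda>s v. \<delta> s + P s *v v) [t..<T] (\<delta> T)"

lemma response_end [simp]: "response T P \<delta> T = \<delta> T"
  by (simp add: response_def)

lemma response_step: "t < T \<Longrightarrow> response T P \<delta> t = \<delta> t + P t *v response T P \<delta> (Suc t)"
  by (simp add: response_def upt_conv_Cons)

lemma response_linear:
  assumes "t \<le> T"
  shows "response T P (\<lambda>r. a *\<^sub>R \<delta> r + b *\<^sub>R \<epsilon> r) t = a *\<^sub>R response T P \<delta> t + b *\<^sub>R response T P \<epsilon> t"
  using assms
  by (induction t rule: inc_induct)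
    (simp_all add: response_step matrix_vector_right_distrib matrix_vector_mult_scaleR algebra_simps)

lemma response_nonneg:
  assumes "t \<le> T" and "\<And>r. r < T \<Longrightarrow> nonneg_mat (P r)" and "\<And>r i. r \<le> T \<Longrightarrow> 0 \<le> \<delta> r $ i"
  shows "0 \<le> response T P \<delta> t $ i"
  using assms(1)
proof (induction t arbitrary: i rule: inc_induct)
  case base
  then show ?case using assms(3) by simp
next
  case (step r)
  then show ?case
    using assms(2,3)[of r]
    by (auto simp: response_step matrix_vector_mult_nth nonneg_mat_def intro!: add_nonneg_nonneg sum_nonneg)
qed

primrec propagate :: "(nat \<Rightarrow> real ^ 'n ^ 'n) \<Rightarrow> real ^ 'n \<Rightarrow> nat \<Rightarrow> real ^ 'n" where
  "propagate P m 0 = m"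
| "propagate P m (Suc t) = transpose (P t) *v propagate P m t"

text \<open>Forward propagation is adjoint to the backward recursion of \<open>response\<close>:
  each \<open>P t\<close> moves across the inner product as its transpose. Applied to multipliers
  \<open>m\<close>, this turns a condition on constraint derivatives into one on marginals.\<close>

lemma inner_response: "m \<bullet> response T P \<delta> 0 = (\<Sum>t\<le>T. propagate P m t \<bullet> \<delta> t)"
proof -
  have "m \<bullet> response T P \<delta> 0 = (\<Sum>r<t. propagate P m r \<bullet> \<delta> r) + propagate P m t \<bullet> response T P \<delta> t"
    if "t \<le> T" for t
    using that
  proof (induction t)
    case (Suc t)
    have "propagate P m t \<bullet> response T P \<delta> t
      = propagate P m t \<bullet> \<delta> t + propagate P m (Suc t) \<bullet> response T P \<delta> (Suc t)"
      using Suc.prems inner_transpose_mult[of "response T P \<delta> (Suc t)" "P t" "propagate P m t"]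
      by (simp add: response_step inner_add_right inner_commute)
    with Suc show ?case by simp
  qed simp
  from this[of T] show ?thesis
    by (simp flip: lessThan_Suc_atMost)
qed

lemma message_pos:
  assumes "t \<le> T" and "\<And>r. r < T \<Longrightarrow> row_stochastic (A r)" and "\<And>r i. r \<le> T \<Longrightarrow> 0 < u r $ i"
  shows "0 < message T A u t $ i"
  using assms(1)
proof (induction t arbitrary: i rule: inc_induct)
  case base
  then show ?case using assms(3) by simp
next
  case (step r)
  then show ?case
    using assms(2,3)[of r] by (simp add: message_step row_stochastic_mult_pos)
qed

text \<open>Raising \<open>t\<close> by one moves the factor diag(u_t) A_t from the message into the
  chain, so the product is constant in \<open>t\<close>. At \<open>t = T\<close> it is the left-hand
  side of the dual constraint.\<close>

lemma scaled_chain_message: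
  assumes "t \<le> T"
  shows "scaled_chain A u t *v message T A u t = message T A u 0"
  using assms
proof (induction t)
  case (Suc t)
  then show ?case
    by (simp add: message_step diag_mat_mult_vec flip: matrix_vector_mul_assoc)
qed simp

text \<open>This is a Doob transform: the message recursion is exactly the normalisation that makes
  each row sum 1.\<close>

lemma row_stochastic_tilted_mat:
  assumes "t < T" and "\<And>r. r < T \<Longrightarrow> row_stochastic (A r)" and "\<And>r i. r \<le> T \<Longrightarrow> 0 < u r $ i"
  shows "row_stochastic (tilted_mat A u (message T A u) t)"
proof -
  let ?W = "message T A u"
  have pos: "0 < ?W t $ i" "0 < ?W (Suc t) $ i" "0 < u t $ i" for i
    using assms by (auto intro: message_pos)
  have "(\<Sum>j\<in>UNIV. tilted_mat A u ?W t $ i $ j) = u t $ i / ?W t $ i * (A t *v ?W (Suc t)) $ i" for i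
    by (simp add: tilted_mat_nth matrix_vector_mult_nth sum_distrib_left mult.assoc)
  also have "\<dots> i = 1" for i
    using pos(1)[of i] pos(3)[of i] \<open>t < T\<close> by (auto simp: message_step)
  finally show ?thesis
    using row_stochasticD(1)[OF assms(2)[OF \<open>t < T\<close>]] pos
    by (auto simp: row_stochastic_def nonneg_mat_def vec_eq_iff matrix_vector_mult_nth tilted_mat_nth less_imp_le)
qed

text \<open>Apply the product rule to one recursion step and divide by
  \<open>message T A u r $ i\<close>: the weights u A W become a row of the tilted matrix, so
  logarithmic derivatives are averaged by it and \<open>\<delta> r\<close> is added.\<close>

lemma message_has_derivative:
  assumes "t \<le> T" and "\<And>r. r < T \<Longrightarrow> row_stochastic (A r)" and "\<And>r i. r \<le> T \<Longrightarrow> 0 < u r $ i"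
  shows "((\<lambda>s. message T A (\<lambda>r. u r * exp_vec (s *\<^sub>R \<delta> r)) t $ i) has_real_derivative
    message T A u t $ i * response T (tilted_mat A u (message T A u)) \<delta> t $ i) (at 0)"
  using assms(1)
proof (induction t arbitrary: i rule: inc_induct)
  case base
  show ?case
    by (auto intro!: derivative_eq_intros)
next
  case (step r)
  let ?u = "\<lambda>s r. u r * exp_vec (s *\<^sub>R \<delta> r)"
  let ?W = "message T A u" and ?P = "tilted_mat A u (message T A u)"
  have pos: "0 < ?W r $ i"
    using assms step.hyps by (intro message_pos) auto
  have eq: "(\<lambda>s. message T A (?u s) r $ i)
    = (\<lambda>s. u r $ i * exp (s * \<delta> r $ i) * (\<Sum>j\<in>UNIV. A r $ i $ j * message T A (?u s) (Suc r) $ j))"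
    using step.hyps by (simp add: message_step matrix_vector_mult_nth)
  have val: "u r $ i * (\<Sum>j\<in>UNIV. A r $ i $ j * ?W (Suc r) $ j) = ?W r $ i"
    using step.hyps by (simp add: message_step matrix_vector_mult_nth)
  let ?R = "response T ?P \<delta>"
  have "((\<lambda>s. message T A (?u s) r $ i) has_real_derivative
      u r $ i * \<delta> r $ i * (\<Sum>j\<in>UNIV. A r $ i $ j * ?W (Suc r) $ j)
      + u r $ i * (\<Sum>j\<in>UNIV. A r $ i $ j * (?W (Suc r) $ j * ?R (Suc r) $ j))) (at 0)"
    unfolding eq
    by (auto intro!: derivative_eq_intros step.IH simp: exp_vec_0 algebra_simps)
  moreover have "u r $ i * \<delta> r $ i * (\<Sum>j\<in>UNIV. A r $ i $ j * ?W (Suc r) $ j)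
      + u r $ i * (\<Sum>j\<in>UNIV. A r $ i $ j * (?W (Suc r) $ j * ?R (Suc r) $ j)) = ?W r $ i * ?R r $ i"
  proof -
    have "?W r $ i * (\<Sum>j\<in>UNIV. ?P r $ i $ j * ?R (Suc r) $ j)
      = u r $ i * (\<Sum>j\<in>UNIV. A r $ i $ j * (?W (Suc r) $ j * ?R (Suc r) $ j))"
      unfolding sum_distrib_left using pos by (intro sum.cong) (simp_all add: tilted_mat_nth)
    moreover have "?W r $ i * ?R r $ i = ?W r $ i * \<delta> r $ i + ?W r $ i * (\<Sum>j\<in>UNIV. ?P r $ i $ j * ?R (Suc r) $ j)"
      using step.hyps by (simp add: response_step matrix_vector_mult_nth distrib_left)
    moreover have "u r $ i * \<delta> r $ i * (\<Sum>j\<in>UNIV. A r $ i $ j * ?W (Suc r) $ j) = ?W r $ i * \<delta> r $ i"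
      by (simp flip: val)
    ultimately show ?thesis by linarith
  qed
  ultimately show ?case by simp
qed

text \<open>
  This covers the active dual constraints for which no strictly feasible direction exists: these
  constraints are constant.
\<close>

lemma message_insensitive:
  assumes "t \<le> T" and stoch: "\<And>r. r < T \<Longrightarrow> row_stochastic (A r)"
    and u: "\<And>r i. r \<le> T \<Longrightarrow> 0 < u r $ i"
    and \<epsilon>: "\<And>r i. r \<le> T \<Longrightarrow> 0 \<le> \<epsilon> r $ i"
    and \<delta>: "\<And>r i. r \<le> T \<Longrightarrow> \<epsilon> r $ i = 0 \<Longrightarrow> \<delta> r $ i = 0"
    and "response T (tilted_mat A u (message T A u)) \<epsilon> t $ i = 0"
  shows "message T A (\<lambda>r. u r * exp_vec (\<delta> r)) t $ i = message T A u t $ i"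
  using assms(1,6)
proof (induction t arbitrary: i rule: inc_induct)
  case base
  then show ?case
    by (simp add: \<delta>)
next
  case (step r)
  let ?W = "message T A u" and ?P = "tilted_mat A u (message T A u)"
  have P: "nonneg_mat (?P q)" if "q < T" for q
    using row_stochastic_tilted_mat[OF that stoch u] by (simp add: row_stochastic_def)
  have R: "0 \<le> response T ?P \<epsilon> (Suc r) $ j" for j
    using step.hyps P \<epsilon> by (intro response_nonneg) auto
  have terms: "0 \<le> ?P r $ i $ j * response T ?P \<epsilon> (Suc r) $ j" for j
    using P[of r] R step.hyps by (simp add: nonneg_mat_def)
  have "\<epsilon> r $ i + (\<Sum>j\<in>UNIV. ?P r $ i $ j * response T ?P \<epsilon> (Suc r) $ j) = 0"
    using step.prems step.hyps by (simp add: response_step matrix_vector_mult_nth)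
  moreover have "0 \<le> \<epsilon> r $ i"
    using \<epsilon> step.hyps by simp
  moreover have "0 \<le> (\<Sum>j\<in>UNIV. ?P r $ i $ j * response T ?P \<epsilon> (Suc r) $ j)"
    by (intro sum_nonneg terms)
  ultimately have "\<epsilon> r $ i = 0" and "(\<Sum>j\<in>UNIV. ?P r $ i $ j * response T ?P \<epsilon> (Suc r) $ j) = 0"
    by linarith+
  then have \<delta>0: "\<delta> r $ i = 0" and 0: "?P r $ i $ j * response T ?P \<epsilon> (Suc r) $ j = 0" for j
    using terms \<delta>[of r] step.hyps by (auto simp: sum_nonneg_eq_0_iff)
  \<comment> \<open>The tilt is nonzero wherever \<open>A r\<close> is, so every successor
    \<open>j\<close> of \<open>i\<close> again has zero response to \<open>\<epsilon>\<close> and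
    the induction hypothesis applies to it.\<close>
  have "A r $ i $ j * message T A (\<lambda>r. u r * exp_vec (\<delta> r)) (Suc r) $ j = A r $ i $ j * ?W (Suc r) $ j" for j
  proof (cases "A r $ i $ j = 0")
    case False
    have "0 < u r $ i" "0 < ?W r $ i" "0 < ?W (Suc r) $ j"
      using step.hyps stoch u by (auto intro: message_pos)
    with False have "?P r $ i $ j \<noteq> 0"
      by (simp add: tilted_mat_nth)
    with 0[of j] have "response T ?P \<epsilon> (Suc r) $ j = 0"
      by simp
    then show ?thesis
      by (simp add: step.IH)
  qed simp
  then have "(A r *v message T A (\<lambda>r. u r * exp_vec (\<delta> r)) (Suc r)) $ i = (A r *v ?W (Suc r)) $ i"
    unfolding matrix_vector_mult_nth by (intro sum.cong) auto
  with \<delta>0 step.hyps show ?case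
    by (simp add: message_step)
qed

section \<open>Lagrange multipliers by separation\<close>

text \<open>Working in the space of constraint values keeps the dimension independent of \<open>T\<close>.\<close>

lemma subspace_avoiding_orthant:
  fixes S :: "(real \<times> (real ^ 'n)) set"
  assumes "subspace S"
    and avoid: "\<And>a x. (a, x) \<in> S \<Longrightarrow> (\<And>i. i \<in> J \<Longrightarrow> x $ i < 0) \<Longrightarrow> a \<le> 0"
    and slater: "(b, y) \<in> S" "\<And>i. i \<in> J \<Longrightarrow> y $ i < 0"
  shows "\<exists>m. (\<forall>i. 0 \<le> m $ i) \<and> (\<forall>i. i \<notin> J \<longrightarrow> m $ i = 0) \<and> (\<forall>(a, x)\<in>S. a = m \<bullet> x)"
proof -
  \<comment> \<open>\<open>Q\<close> collects a positive gain together with strict decrease of the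
    constraints in \<open>J\<close>; \<open>avoid\<close> says that no element of \<open>S\<close>
    achieves both.\<close>
  define Q :: "(real \<times> (real ^ 'n)) set" where "Q = {(a, x). 0 < a \<and> (\<forall>i\<in>J. x $ i < 0)}"
  have "Q = {0<..} \<times> {x. \<forall>i\<in>J. x $ i < 0}"
    by (auto simp: Q_def)
  moreover have "convex {x :: real ^ 'n. \<forall>i\<in>J. x $ i < 0}"
    by (auto intro!: convexI convex_bound_lt)
  ultimately have "convex Q"
    by (simp add: convex_Times)
  have "(1, - 1) \<in> Q"
    by (simp add: Q_def)
  have "S \<inter> Q = {}"
    using avoid by (force simp: Q_def)
  then obtain c \<beta> where nz: "c \<noteq> (0 :: real \<times> (real ^ 'n))"
    and S: "\<And>z. z \<in> S \<Longrightarrow> c \<bullet> z \<le> \<beta>" and Q: "\<And>z. z \<in> Q \<Longrightarrow> \<beta> \<le> c \<bullet> z"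
    using separating_hyperplane_sets[of S Q] subspace_imp_convex[OF assms(1)] \<open>convex Q\<close> slater(1) \<open>(1, - 1) \<in> Q\<close>
    by blast
  have \<beta>: "0 \<le> \<beta>"
    using S[OF subspace_0[OF assms(1)]] by simp
  \<comment> \<open>A linear functional bounded above on a subspace vanishes there: otherwise some
    multiple of \<open>z\<close> takes the value \<open>\<beta> + 1\<close>.\<close>
  have S0: "c \<bullet> z = 0" if "z \<in> S" for z
  proof (rule ccontr)
    assume "c \<bullet> z \<noteq> 0"
    have "((\<beta> + 1) / (c \<bullet> z)) *\<^sub>R z \<in> S"
      using assms(1) that by (rule subspace_scale)
    from S[OF this] \<open>c \<bullet> z \<noteq> 0\<close> show False by simp
  qed
  obtain \<alpha> \<gamma> where c: "c = (\<alpha>, \<gamma>)" by force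
  have Q': "0 \<le> \<alpha> * a + \<gamma> \<bullet> x" if "0 < a" "\<And>i. i \<in> J \<Longrightarrow> x $ i < 0" for a x
    using Q[of "(a, x)"] \<beta> that by (simp add: Q_def c)
  \<comment> \<open>Test the separation at gain 1 and the vector -1 with coordinate \<open>i\<close>
    moved by \<open>k\<close>. This point lies in \<open>Q\<close> for every \<open>k\<close> if
    \<open>i\<close> is outside \<open>J\<close>, and for \<open>k\<close> at most 0
    otherwise.\<close>
  have shift: "0 \<le> \<alpha> - (\<Sum>j\<in>UNIV. \<gamma> $ j) + k * \<gamma> $ i" if "i \<in> J \<Longrightarrow> k \<le> 0" for k i
  proof -
    have "\<gamma> \<bullet> (- 1 + k *\<^sub>R axis i 1) = k * \<gamma> $ i - (\<Sum>j\<in>UNIV. \<gamma> $ j)"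
      unfolding inner_add_right inner_scaleR_right inner_axis by (simp add: inner_vec_def sum_negf)
    moreover have "(- 1 + k *\<^sub>R axis i 1 :: real ^ 'n) $ j < 0" if "j \<in> J" for j
      using that \<open>i \<in> J \<Longrightarrow> k \<le> 0\<close> by (auto simp: axis_def)
    ultimately show ?thesis
      using Q'[of 1 "- 1 + k *\<^sub>R axis i 1"] by simp
  qed
  \<comment> \<open>The value of \<open>k\<close> makes the expression in \<open>shift\<close>
    negative unless \<open>\<gamma> $ i\<close> is 0. Hence \<open>\<gamma>\<close> vanishes outside
    \<open>J\<close> and is nonpositive on \<open>J\<close>.\<close>
  define k where "k i = - (\<bar>\<alpha> - (\<Sum>j\<in>UNIV. \<gamma> $ j)\<bar> + 1) / \<gamma> $ i" for i
  have k: "\<gamma> $ i = 0" if "i \<in> J \<Longrightarrow> k i \<le> 0" for i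
  proof (rule ccontr)
    assume "\<gamma> $ i \<noteq> 0"
    then have "k i * \<gamma> $ i = - (\<bar>\<alpha> - (\<Sum>j\<in>UNIV. \<gamma> $ j)\<bar> + 1)"
      by (simp add: k_def)
    with shift[of i "k i"] that show False by simp
  qed
  have \<gamma>0: "\<gamma> $ i = 0" if "i \<notin> J" for i
    using k that by blast
  have \<gamma>: "\<gamma> $ i \<le> 0" for i
  proof (rule ccontr)
    assume "\<not> \<gamma> $ i \<le> 0"
    moreover from this have "k i \<le> 0"
      unfolding k_def by (intro divide_nonpos_pos) auto
    ultimately show False using k[of i] by simp
  qed
  \<comment> \<open>This is where the Slater point enters: with \<open>\<alpha> = 0\<close> the
    inner product of \<open>\<gamma>\<close> and \<open>y\<close> is a vanishing sum of nonnegative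
    terms, and \<open>y\<close> is strictly negative on \<open>J\<close>, so \<open>\<gamma>\<close>
    would be 0 as well.\<close>
  have "\<alpha> \<noteq> 0"
  proof
    assume "\<alpha> = 0"
    then have "(\<Sum>i\<in>UNIV. \<gamma> $ i * y $ i) = 0"
      using S0[OF slater(1)] by (simp add: c inner_vec_def)
    moreover have "0 \<le> \<gamma> $ i * y $ i" for i
      using \<gamma>[of i] \<gamma>0[of i] slater(2)[of i] by (cases "i \<in> J") (auto simp: mult_nonpos_nonpos)
    ultimately have "\<gamma> $ i * y $ i = 0" for i
      by (simp add: sum_nonneg_eq_0_iff)
    then have "\<gamma> = 0"
      using \<gamma>0 slater(2) by (fastforce simp: vec_eq_iff)
    with nz \<open>\<alpha> = 0\<close> show False by (simp add: c zero_prod_def)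
  qed
  moreover have "0 \<le> \<alpha>"
  proof (rule ccontr)
    assume "\<not> 0 \<le> \<alpha>"
    \<comment> \<open>This gain makes its product with \<open>\<alpha>\<close> outweigh the
      contribution of \<open>\<gamma>\<close> at the vector -1.\<close>
    then have "0 < (\<bar>\<Sum>j\<in>UNIV. \<gamma> $ j\<bar> + 1) / - \<alpha>"
      by (intro divide_pos_pos) auto
    from Q'[OF this, of "- 1"] \<open>\<alpha> \<noteq> 0\<close> show False
      by (simp add: inner_vec_def sum_negf)
  qed
  ultimately have "0 < \<alpha>" by simp
  \<comment> \<open>Solving c . (a, x) = 0 for \<open>a\<close> gives the multiplier vector.\<close>
  have "0 \<le> (- (1 / \<alpha>) *\<^sub>R \<gamma>) $ i" for i
    using \<gamma>[of i] \<open>0 < \<alpha>\<close> by (simp add: divide_nonpos_pos)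
  moreover have "(- (1 / \<alpha>) *\<^sub>R \<gamma>) $ i = 0" if "i \<notin> J" for i
    using \<gamma>0[OF that] by simp
  moreover have "a = (- (1 / \<alpha>) *\<^sub>R \<gamma>) \<bullet> x" if "(a, x) \<in> S" for a x
    using S0[OF that] \<open>0 < \<alpha>\<close> by (simp add: c field_simps)
  ultimately show ?thesis by blast
qed

section \<open>Marginals of feasible flows and divergences from tilted kernels\<close>

definition flow_marginal :: "nat \<Rightarrow> (nat \<Rightarrow> real ^ 'n ^ 'n) \<Rightarrow> nat \<Rightarrow> real ^ 'n" where
  "flow_marginal T M t = (if t < T then M t *v 1 else transpose (M (T - 1)) *v 1)"

text \<open>Constraint (iii) identifies the column marginal of \<open>M t\<close> with the row
  marginal of \<open>M (Suc t)\<close>, so one sequence indexed by 0 to \<open>T\<close> carries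
  both, and (i) and (ii) become a single condition.\<close>

lemma primal_feasible_marginal:
  assumes "primal_feasible T A C \<rho> M" and "1 \<le> T"
  shows "t < T \<Longrightarrow> M t *v 1 = flow_marginal T M t"
    and "t < T \<Longrightarrow> transpose (M t) *v 1 = flow_marginal T M (Suc t)"
    and "t \<le> T \<Longrightarrow> C *v flow_marginal T M t = \<rho> t"
proof -
  show "t < T \<Longrightarrow> M t *v 1 = flow_marginal T M t"
    by (simp add: flow_marginal_def)
  show "transpose (M t) *v 1 = flow_marginal T M (Suc t)" if "t < T"
  proof (cases "Suc t < T")
    case True
    then have "M (Suc t) *v 1 = transpose (M (Suc t - 1)) *v 1"
      using assms(1) unfolding primal_feasible_def by fastforce
    with True show ?thesis by (simp add: flow_marginal_def)
  next
    case False
    with that have "T = Suc t" by simp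
    then show ?thesis by (simp add: flow_marginal_def)
  qed
  show "C *v flow_marginal T M t = \<rho> t" if "t \<le> T"
    using assms that by (auto simp: primal_feasible_def flow_marginal_def order.order_iff_strict)
qed

text \<open>For positive \<open>p\<close> this is ln x \<le> x - 1 at x = q/p, multiplied by
  \<open>p\<close>, with equality only at x = 1. For \<open>p = 0\<close> the term is
  \<open>q\<close>.\<close>

lemma divergence_term_nonneg:
  fixes p q :: real
  assumes "0 \<le> p" and "0 \<le> q" and "q = 0 \<Longrightarrow> p = 0"
  shows "0 \<le> p * ln (p / q) - p + q" and "p * ln (p / q) - p + q = 0 \<Longrightarrow> p = q"
proof -
  show "0 \<le> p * ln (p / q) - p + q"
  proof (cases "p = 0")
    case False
    with assms have pq: "0 < p" "0 < q" by (auto simp: less_le)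
    then have "p * ln (q / p) \<le> p * (q / p - 1)"
      by (intro mult_left_mono ln_le_minus_one) auto
    also have "\<dots> = q - p"
      using pq by (simp add: right_diff_distrib)
    finally show ?thesis
      using pq by (simp add: ln_div right_diff_distrib)
  qed (use assms in simp)
  show "p = q" if eq: "p * ln (p / q) - p + q = 0"
  proof (cases "p = 0")
    case False
    with assms have pq: "0 < p" "0 < q" by (auto simp: less_le)
    with eq have "ln (q / p) = q / p - 1"
      by (simp add: ln_div field_simps)
    then have "q / p = 1"
      using pq by (intro ln_eq_minus_one) auto
    with pq show ?thesis by simp
  qed (use eq in simp)
qed

lemma divergence_nonneg:
  assumes "\<And>i j. 0 \<le> P $ i $ j" and "\<And>i j. 0 \<le> Q $ i $ j" and "\<And>i j. Q $ i $ j = 0 \<Longrightarrow> P $ i $ j = 0"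
  shows "0 \<le> divergence P Q" and "divergence P Q = 0 \<Longrightarrow> P = Q"
proof -
  note terms = divergence_term_nonneg[OF assms]
  show "0 \<le> divergence P Q"
    unfolding divergence_def by (intro sum_nonneg terms(1))
  show "P = Q" if "divergence P Q = 0"
    using that terms
    by (simp add: divergence_def sum_nonneg_eq_0_iff sum_nonneg vec_eq_iff)
qed

text \<open>The logarithm of the tilt splits into a part depending on the row and a part depending
  on the column, which pair with the two marginals of \<open>M\<close>. The linear terms cancel
  because both kernels have row sums 1.\<close>

lemma divergence_tilted_mat:
  fixes M :: "real ^ 'n ^ 'n" and A :: "nat \<Rightarrow> real ^ 'n ^ 'n" and u w :: "nat \<Rightarrow> real ^ 'n" and t :: nat
  defines "m \<equiv> M *v 1" and "B \<equiv> tilted_mat A u w t"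
  assumes M: "nonneg_mat M" "supp_mat M \<subseteq> supp_mat (A t)"
    and A: "row_stochastic (A t)" and B: "row_stochastic B"
    and pos: "\<And>i. 0 < u t $ i" "\<And>i. 0 < w t $ i" "\<And>i. 0 < w (Suc t) $ i"
  shows "divergence M (diag_mat m ** A t) = divergence M (diag_mat m ** B)
    + m \<bullet> (\<chi> i. ln (u t $ i)) - m \<bullet> (\<chi> i. ln (w t $ i)) + (transpose M *v 1) \<bullet> (\<chi> i. ln (w (Suc t) $ i))"
proof -
  have m: "m $ i = (\<Sum>j\<in>UNIV. M $ i $ j)" for i
    by (simp add: m_def matrix_vector_mult_nth)
  have "M $ i $ j * ln (M $ i $ j / (m $ i * A t $ i $ j))
      = M $ i $ j * ln (M $ i $ j / (m $ i * B $ i $ j))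
        + M $ i $ j * (ln (u t $ i) - ln (w t $ i) + ln (w (Suc t) $ j))" for i j
  proof (cases "M $ i $ j = 0")
    case False
    have M0: "0 \<le> M $ i $ j" for j
      using M(1) by (simp add: nonneg_mat_def)
    have "(i, j) \<in> supp_mat (A t)"
      using False M(2) by (auto simp: supp_mat_def)
    then have "0 < A t $ i $ j"
      using row_stochasticD(1)[OF A, of i j] by (simp add: supp_mat_def)
    moreover have "0 < M $ i $ j"
      using False M0[of j] by simp
    moreover have "0 < m $ i"
      unfolding m using M0 \<open>0 < M $ i $ j\<close> by (intro sum_pos2[of UNIV j]) auto
    ultimately show ?thesis
      using pos(1)[of i] pos(2)[of i] pos(3)[of j]
      by (simp add: B_def tilted_mat_nth ln_div ln_mult algebra_simps)
  qed simp
  then have "divergence M (diag_mat m ** A t) - divergence M (diag_mat m ** B)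
      = (\<Sum>i\<in>UNIV. \<Sum>j\<in>UNIV. M $ i $ j * (ln (u t $ i) - ln (w t $ i) + ln (w (Suc t) $ j)))
        + (\<Sum>i\<in>UNIV. \<Sum>j\<in>UNIV. m $ i * A t $ i $ j) - (\<Sum>i\<in>UNIV. \<Sum>j\<in>UNIV. m $ i * B $ i $ j)"
    by (simp add: divergence_def diag_mat_mult_nth sum.distrib sum_subtractf)
  also have "\<dots> = (\<Sum>i\<in>UNIV. \<Sum>j\<in>UNIV. M $ i $ j * (ln (u t $ i) - ln (w t $ i) + ln (w (Suc t) $ j)))"
    by (simp add: row_stochasticD(2)[OF A] row_stochasticD(2)[OF B] flip: sum_distrib_left)
  also have "\<dots> = m \<bullet> (\<chi> i. ln (u t $ i)) - m \<bullet> (\<chi> i. ln (w t $ i))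
      + (\<Sum>i\<in>UNIV. \<Sum>j\<in>UNIV. M $ i $ j * ln (w (Suc t) $ j))"
    by (simp add: inner_vec_def m sum_distrib_right distrib_left right_diff_distrib sum.distrib sum_subtractf)
  also have "(\<Sum>i\<in>UNIV. \<Sum>j\<in>UNIV. M $ i $ j * ln (w (Suc t) $ j))
      = (transpose M *v 1) \<bullet> (\<chi> i. ln (w (Suc t) $ i))"
    by (subst sum.swap) (simp add: inner_vec_def matrix_vector_mult_nth transpose_def sum_distrib_right)
  finally show ?thesis by simp
qed

section \<open>The duality gap\<close>

lemma dual_scaling_pos: "0 < dual_scaling C lam t $ i"
  by (simp add: dual_scaling_def)

lemma dual_feasible_message: "dual_feasible T A C lam \<longleftrightarrow> message T A (dual_scaling C lam) 0 \<le> 1"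
  using scaled_chain_message[of T T A "dual_scaling C lam"] by (simp add: dual_feasible_def)

text \<open>Summing \<open>divergence_tilted_mat\<close> over \<open>t\<close>, the terms in ln W
  telescope along the marginals, while ln u_t is the transpose of \<open>C\<close> applied to
  \<open>lam t\<close> and pairs with the marginal to
  \<open>lam t \<bullet> \<rho> t\<close>.\<close>

lemma duality_gap:
  fixes T :: nat and A :: "nat \<Rightarrow> real ^ 'n ^ 'n" and C :: "real ^ 'n ^ 'k" and lam :: "nat \<Rightarrow> real ^ 'k"
  defines "u \<equiv> dual_scaling C lam"
  defines "W \<equiv> message T A u"
  assumes "1 \<le> T" and stoch: "\<And>t. t < T \<Longrightarrow> row_stochastic (A t)" and feas: "primal_feasible T A C \<rho> M"
  shows "primal_objective T A M = dual_objective T \<rho> lam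
    + (\<Sum>t<T. divergence (M t) (diag_mat (M t *v 1) ** tilted_mat A u W t))
    - (M 0 *v 1) \<bullet> (\<chi> i. ln (W 0 $ i))"
proof -
  let ?m = "flow_marginal T M"
  let ?L = "\<lambda>t. \<chi> i. ln (W t $ i)"
  have u: "0 < u t $ i" for t i
    by (simp add: u_def dual_scaling_pos)
  have W: "0 < W t $ i" if "t \<le> T" for t i
    unfolding W_def using that stoch u by (intro message_pos) auto
  have lnu: "?m t \<bullet> (\<chi> i. ln (u t $ i)) = lam t \<bullet> \<rho> t" if "t \<le> T" for t
    using primal_feasible_marginal(3)[OF feas \<open>1 \<le> T\<close> that]
    by (simp add: u_def dual_scaling_def inner_transpose_mult inner_commute)
  have "divergence (M t) (diag_mat (M t *v 1) ** A t)
      = divergence (M t) (diag_mat (M t *v 1) ** tilted_mat A u W t)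
        + lam t \<bullet> \<rho> t + (?m (Suc t) \<bullet> ?L (Suc t) - ?m t \<bullet> ?L t)" if "t < T" for t
  proof -
    have "row_stochastic (tilted_mat A u W t)"
      unfolding W_def using that stoch u by (intro row_stochastic_tilted_mat) auto
    then show ?thesis
      using divergence_tilted_mat[of "M t" A t u W] that feas stoch u W lnu[of t]
        primal_feasible_marginal(1,2)[OF feas \<open>1 \<le> T\<close> that]
      by (simp add: primal_feasible_def)
  qed
  then have "primal_objective T A M
      = (\<Sum>t<T. divergence (M t) (diag_mat (M t *v 1) ** tilted_mat A u W t))
        + (\<Sum>t<T. lam t \<bullet> \<rho> t) + (?m T \<bullet> ?L T - ?m 0 \<bullet> ?L 0)"
    using sum_lessThan_telescope[of "\<lambda>t. ?m t \<bullet> ?L t" T]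
    by (simp add: primal_objective_def sum.distrib)
  \<comment> \<open>The upper boundary term of the telescope supplies the summand of the dual
    objective at index \<open>T\<close>.\<close>
  moreover have "?L T = (\<chi> i. ln (u T $ i))"
    by (simp add: W_def)
  ultimately show ?thesis
    using lnu[of T] \<open>1 \<le> T\<close>
    by (simp add: dual_objective_def flow_marginal_def flip: lessThan_Suc_atMost)
qed


section \<open>Strong duality and the resulting optimality conditions\<close>

lemma transpose_mult_nth: "(transpose B *v x) $ i = (\<Sum>j\<in>UNIV. B $ j $ i * x $ j)"
  by (simp add: matrix_vector_mult_nth transpose_def)

lemma transpose_diag_mat_mult_vec: "transpose (diag_mat m ** B) *v 1 = transpose B *v m"
  by (simp add: vec_eq_iff transpose_mult_nth diag_mat_mult_nth mult.commute)

lemma diag_mat_mult_row_stochastic: "row_stochastic B \<Longrightarrow> (diag_mat m ** B) *v 1 = m"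
  by (simp add: row_stochastic_def diag_mat_mult_vec flip: matrix_vector_mul_assoc)

lemma divergence_self [simp]: "divergence P P = 0"
proof -
  have "x * ln (x / x) - x + x = 0" for x :: real
    by (cases "x = 0") auto
  then show ?thesis
    unfolding divergence_def by (simp only: sum.neutral_const)
qed

lemma propagate_nonneg:
  assumes "\<And>r. r < T \<Longrightarrow> nonneg_mat (P r)" and "\<And>i. 0 \<le> m $ i" and "t \<le> T"
  shows "0 \<le> propagate P m t $ i"
  using assms(3)
proof (induction t arbitrary: i)
  case (Suc t)
  then show ?case
    using assms(1)[of t] by (auto simp: transpose_mult_nth nonneg_mat_def intro!: sum_nonneg)
qed (simp add: assms)

lemma dual_scaling_perturb:
  "dual_scaling C (\<lambda>r. lam r + s *\<^sub>R d r)
    = (\<lambda>r. dual_scaling C lam r * exp_vec (s *\<^sub>R (transpose C *v d r)))"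
  by (simp add: fun_eq_iff dual_scaling_def vec_eq_iff matrix_vector_right_distrib
      matrix_vector_mult_scaleR exp_add)

text \<open>The multipliers \<open>m\<close> of the dual constraints serve as initial marginal of a
  chain with kernels \<open>P\<close>. Stationarity in \<open>lam t\<close> becomes the marginal
  constraint at time \<open>t\<close>, and complementary slackness removes the term in ln
  W_0.\<close>

lemma strong_duality:
  fixes T :: nat and A :: "nat \<Rightarrow> real ^ 'n ^ 'n" and C :: "real ^ 'n ^ 'k" and lam :: "nat \<Rightarrow> real ^ 'k"
  assumes "1 \<le> T" and stoch: "\<And>t. t < T \<Longrightarrow> row_stochastic (A t)" and C: "nonneg_mat C"
    and opt: "dual_optimal T A C \<rho> lam"
  obtains M where "primal_feasible T A C \<rho> M" and "primal_objective T A M = dual_objective T \<rho> lam"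
proof -
  define u where "u = dual_scaling C lam"
  define W where "W = message T A u"
  define P where "P = tilted_mat A u W"
  define G where "G d = response T P (\<lambda>r. transpose C *v d r) 0" for d
  \<comment> \<open>These are the active constraints that react to raising all of
    \<open>lam\<close>. On them the direction -1 is strictly decreasing, which gives the Slater
    point; every other active constraint is constant in all directions.\<close>
  define J where "J = {i. W 0 $ i = 1 \<and> 0 < G (\<lambda>_. 1) $ i}"
  define S where "S = range (\<lambda>d. (dual_objective T \<rho> d, G d))"
  have u: "0 < u t $ i" for t i
    by (simp add: u_def dual_scaling_pos)
  have P: "row_stochastic (P t)" if "t < T" for t
    unfolding P_def W_def using that stoch u by (intro row_stochastic_tilted_mat) auto
  then have P_nonneg: "nonneg_mat (P t)" if "t < T" for t
    using that by (simp add: row_stochastic_def)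
  have W0: "W 0 $ i \<le> 1" for i
    using opt by (simp add: dual_optimal_def dual_feasible_message W_def u_def less_eq_vec_def)
  have ones_nonneg: "0 \<le> (transpose C *v 1) $ i" for i
    using C by (auto simp: transpose_mult_nth nonneg_mat_def intro!: sum_nonneg)
  have ones_0: "(transpose C *v x) $ i = 0" if "(transpose C *v 1) $ i = 0" for x i
    using C that by (simp add: transpose_mult_nth nonneg_mat_def sum_nonneg_eq_0_iff)
  have G_linear: "G (\<lambda>r. a *\<^sub>R d r + b *\<^sub>R e r) = a *\<^sub>R G d + b *\<^sub>R G e" for a b d e
    by (simp add: G_def response_linear matrix_vector_right_distrib matrix_vector_mult_scaleR)
  have D_linear: "dual_objective T \<rho> (\<lambda>r. a *\<^sub>R d r + b *\<^sub>R e r)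
      = a * dual_objective T \<rho> d + b * dual_objective T \<rho> e" for a b d e
    by (simp add: dual_objective_def inner_add_left sum.distrib sum_distrib_left)
  have G_ones: "0 \<le> G (\<lambda>_. 1) $ i" for i
    unfolding G_def using P_nonneg ones_nonneg by (intro response_nonneg) auto
  have subspace: "subspace S"
  proof (rule subspaceI)
    let ?F = "\<lambda>d. (dual_objective T \<rho> d, G d)"
    have F: "a *\<^sub>R ?F d + b *\<^sub>R ?F e \<in> S" for a b d e
      unfolding S_def by (rule range_eqI[of _ _ "\<lambda>r. a *\<^sub>R d r + b *\<^sub>R e r"]) (simp add: G_linear D_linear)
    show "0 \<in> S"
      using F[of 0 _ 0] by (simp add: zero_prod_def)
    show "x + y \<in> S" if "x \<in> S" "y \<in> S" for x y
      using that F[of 1 _ 1] by (auto simp: S_def)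
    show "c *\<^sub>R x \<in> S" if "x \<in> S" for c x
      using that F[of c _ 0] by (auto simp: S_def)
  qed
  \<comment> \<open>A violation would be a direction \<open>d\<close> along which a small step from
    \<open>lam\<close> stays feasible and increases the dual objective.\<close>
  have avoid: "a \<le> 0" if "(a, x) \<in> S" and x: "\<And>i. i \<in> J \<Longrightarrow> x $ i < 0" for a x
  proof (rule ccontr)
    assume "\<not> a \<le> 0"
    obtain d where d: "a = dual_objective T \<rho> d" "x = G d"
      using \<open>(a, x) \<in> S\<close> by (auto simp: S_def)
    define f where "f s = message T A (\<lambda>r. u r * exp_vec (s *\<^sub>R (transpose C *v d r))) 0" for s
    have f0: "f 0 = W 0"
      by (simp add: f_def W_def exp_vec_0)
    have deriv: "((\<lambda>s. f s $ i) has_real_derivative W 0 $ i * x $ i) (at 0)" for i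
      unfolding f_def W_def d G_def P_def using stoch u by (intro message_has_derivative) auto
    have "\<forall>\<^sub>F s in at_right 0. f s $ i \<le> 1" for i
    proof -
      \<comment> \<open>Inactive constraints survive by continuity, those in \<open>J\<close> by
        their negative derivative, and the rest because they do not change.\<close>
      consider "W 0 $ i < 1" | "i \<in> J" | "W 0 $ i = 1" "G (\<lambda>_. 1) $ i = 0"
        using W0[of i] G_ones[of i] by (force simp: J_def)
      then show ?thesis
      proof cases
        case 1
        have "((\<lambda>s. f s $ i) \<longlongrightarrow> f 0 $ i) (at_right 0)"
          using DERIV_isCont[OF deriv] by (auto simp: isCont_def intro: tendsto_within_subset)
        from order_tendstoD(2)[OF this, of 1] 1 show ?thesis
          by (auto simp: f0 elim: eventually_mono)
      next
        case 2
        then have "W 0 $ i * x $ i < 0"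
          using x by (simp add: J_def)
        from DERIV_neg_dec_right[OF deriv this]
        obtain e where "0 < e" "\<And>h. 0 < h \<Longrightarrow> h < e \<Longrightarrow> f h $ i < f 0 $ i"
          by auto
        with 2 show ?thesis
          unfolding eventually_at_right_field by (force simp: f0 J_def)
      next
        case 3
        have "f s $ i = W 0 $ i" for s
          unfolding f_def W_def
        proof (rule message_insensitive[where \<epsilon> = "\<lambda>_. transpose C *v 1"])
          show "response T (tilted_mat A u (message T A u)) (\<lambda>_. transpose C *v 1) 0 $ i = 0"
            using 3 by (simp add: G_def P_def W_def)
        qed (use stoch u ones_nonneg ones_0 in auto)
        with 3 show ?thesis by simp
      qed
    qed
    then have "\<forall>\<^sub>F s in at_right 0. \<forall>i. f s $ i \<le> 1"
      by (simp add: eventually_all_finite)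
    then have "\<forall>\<^sub>F s in at_right 0. 0 < s \<and> (\<forall>i. f s $ i \<le> 1)"
      using eventually_at_right_less by (rule eventually_elim2) auto
    then obtain s :: real where "0 < s" and s: "\<And>i. f s $ i \<le> 1"
      using eventually_happens'[OF trivial_limit_at_right_real] by blast
    have "dual_feasible T A C (\<lambda>r. lam r + s *\<^sub>R d r)"
      using s by (simp add: dual_feasible_message dual_scaling_perturb f_def u_def less_eq_vec_def)
    then have "dual_objective T \<rho> (\<lambda>r. lam r + s *\<^sub>R d r) \<le> dual_objective T \<rho> lam"
      using opt by (simp add: dual_optimal_def)
    then have "s * a \<le> 0"
      using D_linear[of 1 lam s d] by (simp add: d)
    with \<open>0 < s\<close> \<open>\<not> a \<le> 0\<close> show False
      by (simp add: mult_le_0_iff)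
  qed
  have slater: "(dual_objective T \<rho> (\<lambda>_. - 1), G (\<lambda>_. - 1)) \<in> S"
    by (auto simp: S_def)
  have slater_neg: "G (\<lambda>_. - 1) $ i < 0" if "i \<in> J" for i
    using that G_linear[of "- 1" "\<lambda>_. 1" 0] by (simp add: J_def)
  have "\<exists>m. (\<forall>i. 0 \<le> m $ i) \<and> (\<forall>i. i \<notin> J \<longrightarrow> m $ i = 0) \<and> (\<forall>(a, x)\<in>S. a = m \<bullet> x)"
    by (rule subspace_avoiding_orthant) (fact subspace avoid slater slater_neg)+
  then obtain m where m: "\<And>i. 0 \<le> m $ i" "\<And>i. i \<notin> J \<Longrightarrow> m $ i = 0"
    and mult: "\<And>d. dual_objective T \<rho> d = m \<bullet> G d"
    by (auto simp: S_def)
  let ?q = "propagate P m"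
  define M where "M t = diag_mat (?q t) ** P t" for t
  have q: "C *v ?q t = \<rho> t" if "t \<le> T" for t
  proof -
    have "v \<bullet> \<rho> t = v \<bullet> (C *v ?q t)" for v
    proof -
      \<comment> \<open>A direction supported at the single time \<open>t\<close> isolates one
        marginal in the multiplier identity.\<close>
      define d where "d r = (if r = t then v else 0)" for r
      have "v \<bullet> \<rho> t = dual_objective T \<rho> d"
        using that by (simp add: dual_objective_def d_def if_distrib[of "\<lambda>x. x \<bullet> _"] cong: if_cong)
      also have "\<dots> = (\<Sum>r\<le>T. (C *v ?q r) \<bullet> d r)"
        by (simp add: mult G_def inner_response inner_transpose_mult)
      also have "\<dots> = v \<bullet> (C *v ?q t)"
        using that by (simp add: d_def if_distrib[of "\<lambda>x. _ \<bullet> x"] inner_commute cong: if_cong)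
      finally show ?thesis .
    qed
    then show ?thesis
      using vector_eq_ldot[of "\<rho> t" "C *v ?q t"] by simp
  qed
  have M1: "M t *v 1 = ?q t" "transpose (M t) *v 1 = ?q (Suc t)" if "t < T" for t
    using P[OF that] by (simp_all add: M_def diag_mat_mult_row_stochastic transpose_diag_mat_mult_vec)
  have "nonneg_mat (M t) \<and> supp_mat (M t) \<subseteq> supp_mat (A t)" if "t < T" for t
  proof
    show "nonneg_mat (M t)"
      using P_nonneg[OF that] propagate_nonneg[of T P m t, OF P_nonneg m(1)] that
      by (simp add: M_def nonneg_mat_def diag_mat_mult_nth)
    show "supp_mat (M t) \<subseteq> supp_mat (A t)"
      by (auto simp: M_def diag_mat_mult_nth supp_mat_def P_def tilted_mat_nth)
  qed
  then have feas: "primal_feasible T A C \<rho> M"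
    using \<open>1 \<le> T\<close> by (auto simp: primal_feasible_def M1 q simp del: propagate.simps)
  moreover have "primal_objective T A M = dual_objective T \<rho> lam"
  proof -
    \<comment> \<open>Complementary slackness: \<open>m\<close> vanishes off \<open>J\<close>, and
      \<open>W 0\<close> equals 1 on \<open>J\<close>.\<close>
    have "m $ i * ln (W 0 $ i) = 0" for i
      using m(2)[of i] by (cases "i \<in> J") (auto simp: J_def)
    then have "(M 0 *v 1) \<bullet> (\<chi> i. ln (W 0 $ i)) = 0"
      using \<open>1 \<le> T\<close> by (auto simp: M1 inner_vec_def intro!: sum.neutral)
    moreover have "divergence (M t) (diag_mat (M t *v 1) ** P t) = 0" if "t < T" for t
      using M1(1)[OF that] by (simp add: M_def)
    ultimately show ?thesis
      using duality_gap[OF \<open>1 \<le> T\<close> stoch feas, of lam]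
      by (simp flip: u_def W_def P_def)
  qed
  ultimately show thesis
    by (rule that)
qed

text \<open>The gap of \<open>N\<close> is a sum of nonnegative terms, and
  \<open>strong_duality\<close> with optimality of \<open>N\<close> bounds it by 0. So every
  divergence vanishes, and so does each summand of the inner product with ln W_0.\<close>

lemma primal_optimal_tilted:
  fixes T :: nat and A :: "nat \<Rightarrow> real ^ 'n ^ 'n" and C :: "real ^ 'n ^ 'k" and lam :: "nat \<Rightarrow> real ^ 'k"
  defines "u \<equiv> dual_scaling C lam"
  defines "W \<equiv> message T A u"
  assumes "1 \<le> T" and stoch: "\<And>t. t < T \<Longrightarrow> row_stochastic (A t)" and C: "nonneg_mat C"
    and dual: "dual_optimal T A C \<rho> lam" and primal: "primal_optimal T A C \<rho> N"
  shows "t < T \<Longrightarrow> N t = diag_mat (N t *v 1) ** tilted_mat A u W t"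
    and "(N 0 *v 1) $ i = 0 \<or> W 0 $ i = 1"
proof -
  let ?D = "\<lambda>t. divergence (N t) (diag_mat (N t *v 1) ** tilted_mat A u W t)"
  let ?m = "N 0 *v 1"
  have u: "0 < u t $ i" for t i
    by (simp add: u_def dual_scaling_pos)
  have W: "0 < W t $ i" if "t \<le> T" for t i
    unfolding W_def using that stoch u by (intro message_pos) auto
  have P: "row_stochastic (tilted_mat A u W t)" if "t < T" for t
    unfolding W_def using that stoch u by (intro row_stochastic_tilted_mat) auto
  have feas: "primal_feasible T A C \<rho> N"
    using primal by (simp add: primal_optimal_def)
  have N: "0 \<le> N t $ i $ j" "A t $ i $ j = 0 \<Longrightarrow> N t $ i $ j = 0" if "t < T" for t i j
  proof -
    have "nonneg_mat (N t)" "supp_mat (N t) \<subseteq> supp_mat (A t)"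
      using feas that by (auto simp: primal_feasible_def)
    then show "0 \<le> N t $ i $ j" "A t $ i $ j = 0 \<Longrightarrow> N t $ i $ j = 0"
      by (auto simp: nonneg_mat_def supp_mat_def)
  qed
  have N1: "0 \<le> (N t *v 1) $ i" if "t < T" for t i
    using N that by (auto simp: matrix_vector_mult_nth intro!: sum_nonneg)
  have N1_0: "N t $ i $ j = 0" if "(N t *v 1) $ i = 0" "t < T" for t i j
    using that N by (simp add: matrix_vector_mult_nth sum_nonneg_eq_0_iff)
  \<comment> \<open>Positive \<open>u\<close> and \<open>W\<close> leave the zero pattern of
    \<open>A t\<close> unchanged, and a zero row sum annihilates a nonnegative row.\<close>
  have supp: "N t $ i $ j = 0" if "(diag_mat (N t *v 1) ** tilted_mat A u W t) $ i $ j = 0" "t < T" for t i j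
  proof -
    have "0 < W t $ i" "0 < W (Suc t) $ j" "0 < u t $ i"
      using W u \<open>t < T\<close> by auto
    with that N(2) N1_0 show ?thesis
      by (auto simp: diag_mat_mult_nth tilted_mat_nth)
  qed
  have D: "0 \<le> ?D t" "?D t = 0 \<Longrightarrow> N t = diag_mat (N t *v 1) ** tilted_mat A u W t" if "t < T" for t
    using that N N1 row_stochasticD(1)[OF P] supp
    by (auto intro!: divergence_nonneg simp: diag_mat_mult_nth)
  have "W 0 $ i \<le> 1" for i
    using dual by (simp add: dual_optimal_def dual_feasible_message W_def u_def less_eq_vec_def)
  then have terms: "0 \<le> - (?m $ i * ln (W 0 $ i))" for i
    using N1[of 0 i] W[of 0 i] \<open>1 \<le> T\<close> by (simp add: mult_nonneg_nonpos)
  have "0 \<le> - (?m \<bullet> (\<chi> i. ln (W 0 $ i)))"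
    using sum_nonneg[of UNIV, OF terms] by (simp add: inner_vec_def sum_negf)
  moreover obtain M where "primal_feasible T A C \<rho> M" "primal_objective T A M = dual_objective T \<rho> lam"
    using strong_duality[OF \<open>1 \<le> T\<close> stoch C dual] by blast
  then have "primal_objective T A N \<le> dual_objective T \<rho> lam"
    using primal by (metis primal_optimal_def)
  moreover have "primal_objective T A N = dual_objective T \<rho> lam + (\<Sum>t<T. ?D t) - ?m \<bullet> (\<chi> i. ln (W 0 $ i))"
    unfolding W_def u_def using duality_gap[OF \<open>1 \<le> T\<close> stoch feas] by blast
  moreover have "0 \<le> (\<Sum>t<T. ?D t)"
    by (intro sum_nonneg D) simp
  ultimately have "(\<Sum>t<T. ?D t) = 0" and m: "?m \<bullet> (\<chi> i. ln (W 0 $ i)) = 0"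
    by linarith+
  then have "?D t = 0" if "t < T" for t
    using D(1) that sum_nonneg_eq_0_iff[of "{..<T}" ?D] by auto
  then show "t < T \<Longrightarrow> N t = diag_mat (N t *v 1) ** tilted_mat A u W t"
    using D(2) by blast
  have "(\<Sum>i\<in>UNIV. - (?m $ i * ln (W 0 $ i))) = 0"
    using m by (simp add: inner_vec_def sum_negf)
  then have "- (?m $ i * ln (W 0 $ i)) = 0"
    using terms by (simp only: sum_nonneg_eq_0_iff finite) simp
  then show "(N 0 *v 1) $ i = 0 \<or> W 0 $ i = 1"
    using W[of 0 i] by auto
qed

section \<open>Differences of optimal flows and the observability kernel\<close>

text \<open>The transposed tilt is diag(w_{t+1}) A_t^T diag(u_t / w_t). Since u_t fixes z_t, the
  quotient z_t / w_t evolves by A_t^T alone, starting from \<open>z 0\<close> because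
  \<open>w 0 = 1\<close>.\<close>

lemma transposed_chain_tilted:
  assumes "t \<le> T" and "w 0 = 1" and w: "\<And>t i. t \<le> T \<Longrightarrow> w t $ i \<noteq> 0"
    and z: "\<And>t. t < T \<Longrightarrow> z (Suc t) = transpose (tilted_mat A u w t) *v z t"
    and u: "\<And>t. t < T \<Longrightarrow> u t * z t = z t"
  shows "transposed_chain A t *v z 0 = div_vec (z t) (w t)"
  using assms(1)
proof (induction t)
  case 0
  then show ?case
    using \<open>w 0 = 1\<close> by (simp add: div_vec_def vec_eq_iff)
next
  case (Suc t)
  have uz: "u t $ i * z t $ i = z t $ i" for i
    using u[of t] Suc.prems by (metis Suc_le_eq vector_mult_component)
  have "(transpose (A t) *v div_vec (z t) (w t)) $ i = z (Suc t) $ i / w (Suc t) $ i" for i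
  proof -
    have "z (Suc t) $ i = (\<Sum>j\<in>UNIV. A t $ j $ i * (u t $ j * z t $ j / w t $ j) * w (Suc t) $ i)"
      using Suc.prems by (simp add: z transpose_mult_nth tilted_mat_nth mult_ac)
    also have "\<dots> = (transpose (A t) *v div_vec (z t) (w t)) $ i * w (Suc t) $ i"
      by (simp add: uz transpose_mult_nth div_vec_def sum_distrib_right)
    finally show ?thesis
      using w[OF Suc.prems, of i] by simp
  qed
  then have "transpose (A t) *v div_vec (z t) (w t) = div_vec (z (Suc t)) (w (Suc t))"
    by (simp add: vec_eq_iff div_vec_def)
  with Suc show ?case
    by (simp flip: matrix_vector_mul_assoc)
qed

text \<open>On selected coordinates \<open>x\<close> is zero; elsewhere the exponent is an empty
  sum, so the scaling is 1.\<close>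

lemma selection_mat_kernel_scaling:
  assumes "selection_mat p *v x = 0"
  shows "dual_scaling (selection_mat p) lam t * x = x"
proof -
  have "x $ i = 0" if "i \<in> range p" for i
    using assms that by (auto simp: vec_eq_iff selection_mat_mult_nth)
  moreover have "dual_scaling (selection_mat p) lam t $ i = 1" if "i \<notin> range p" for i
  proof -
    have "{a. p a = i} = {}"
      using that by auto
    then show ?thesis
      by (simp add: dual_scaling_def transpose_selection_mat_mult_nth)
  qed
  ultimately have "dual_scaling (selection_mat p) lam t $ i * x $ i = x $ i" for i
    by (cases "i \<in> range p") simp_all
  then show ?thesis
    by (simp add: vec_eq_iff)
qed

theorem theorem2:
  fixes T :: nat
    and A :: "nat \<Rightarrow> real ^ 'n ^ 'n"
    and p :: "'k::finite \<Rightarrow> 'n"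
    and C :: "real ^ 'n ^ 'k"
    and \<rho> lam :: "nat \<Rightarrow> real ^ 'k"
    and M' N :: "nat \<Rightarrow> real ^ 'n ^ 'n"
    and u w :: "nat \<Rightarrow> real ^ 'n"
    and A' :: "nat \<Rightarrow> real ^ 'n ^ 'n"
  assumes "T \<ge> 1"
    and "\<And>t. t < T \<Longrightarrow> row_stochastic (A t)"
    and "inj p"
    and "C = selection_mat p"
    and "\<exists>M. primal_feasible T A C \<rho> M \<and> (\<forall>t<T. \<forall>i j. A t $ i $ j > 0 \<longrightarrow> M t $ i $ j > 0)"
    and "primal_optimal T A C \<rho> M'"
    and "dual_optimal T A C \<rho> lam"
    and "\<And>t. t \<le> T \<Longrightarrow> u t = dual_scaling C lam t"
    and "w 0 = 1"
    and "w T = u T"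
    and "\<And>t. t \<in> {1..<T} \<Longrightarrow> w t = u t * (A t *v w (t + 1))"
    and "\<And>t. t < T \<Longrightarrow> A' t = tilted_mat A u w t"
    and "primal_optimal T A C \<rho> N"
  shows "\<exists>z :: nat \<Rightarrow> real ^ 'n.
           (\<forall>t<T. N t = M' t + diag_mat (z t) ** A' t \<and> z (t + 1) = transpose (A' t) *v z t) \<and>
           z 0 \<in> observability_kernel T A C \<and>
           M' 0 *v 1 + z 0 \<ge> 0"
proof -
  let ?v = "dual_scaling C lam"
  \<comment> \<open>\<open>W\<close> agrees with \<open>w\<close> from index 1 on; at index 0 it is
    the dual constraint value instead of 1.\<close>
  define W where "W = message T A ?v"
  have C: "nonneg_mat C"
    by (auto simp: assms(4) nonneg_mat_def selection_mat_def axis_def)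
  have W_pos: "0 < W t $ i" if "t \<le> T" for t i
    unfolding W_def using that assms(2) dual_scaling_pos by (intro message_pos) auto
  have w: "w t = W t" if "1 \<le> t" "t \<le> T" for t
    using that(2,1)
  proof (induction t rule: inc_induct)
    case base
    then show ?case using assms(8,10) by (simp add: W_def)
  next
    case (step r)
    then show ?case using assms(8,11)[of r] by (simp add: W_def message_step)
  qed
  have w_nonzero: "w t $ i \<noteq> 0" if "t \<le> T" for t i
  proof (cases "t = 0")
    case False
    with w[of t] W_pos[OF that, of i] that show ?thesis by simp
  qed (simp add: assms(9))
  \<comment> \<open>Only \<open>t = 0\<close> needs care: rows on which \<open>W 0\<close> differs
    from 1 carry no mass of an optimal flow, so replacing \<open>W 0\<close> by \<open>w 0\<close>
    leaves the product unchanged.\<close>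
  have tilted: "M t = diag_mat (M t *v 1) ** A' t" if opt: "primal_optimal T A C \<rho> M" and "t < T" for M t
  proof -
    have tilt: "M t = diag_mat (M t *v 1) ** tilted_mat A ?v W t" "(M 0 *v 1) $ i = 0 \<or> W 0 $ i = 1" for i
      using primal_optimal_tilted[OF assms(1,2) C assms(7) opt] \<open>t < T\<close> unfolding W_def by blast+
    have "(diag_mat (M t *v 1) ** tilted_mat A ?v W t) $ i $ j = (diag_mat (M t *v 1) ** A' t) $ i $ j" for i j
      using tilt(2)[of i] \<open>t < T\<close> assms(8)[of t] w[of t] w[of "Suc t"] assms(9)
      by (cases "t = 0") (auto simp: diag_mat_mult_nth assms(12) tilted_mat_nth)
    then have "diag_mat (M t *v 1) ** tilted_mat A ?v W t = diag_mat (M t *v 1) ** A' t"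
      by (simp add: vec_eq_iff)
    with tilt(1) show ?thesis by (rule trans)
  qed
  define z where "z t = flow_marginal T N t - flow_marginal T M' t" for t
  have feas: "primal_feasible T A C \<rho> N" "primal_feasible T A C \<rho> M'"
    using assms(6,13) by (simp_all add: primal_optimal_def)
  note marginal = primal_feasible_marginal[OF feas(1) assms(1)] primal_feasible_marginal[OF feas(2) assms(1)]
  have z: "N t *v 1 - M' t *v 1 = z t" if "t < T" for t
    using marginal that by (simp add: z_def)
  \<comment> \<open>Both flows factor through the same kernel \<open>A' t\<close>, so their
    difference is the difference of marginals times that kernel.\<close>
  have N_eq: "N t = M' t + diag_mat (z t) ** A' t" if "t < T" for t
  proof -
    have "N t $ i $ j = (N t *v 1) $ i * A' t $ i $ j" "M' t $ i $ j = (M' t *v 1) $ i * A' t $ i $ j" for i j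
      using arg_cong[OF tilted[OF assms(13) that], of "\<lambda>X. X $ i $ j"]
        arg_cong[OF tilted[OF assms(6) that], of "\<lambda>X. X $ i $ j"] by (simp_all only: diag_mat_mult_nth)
    then show ?thesis
      by (simp add: vec_eq_iff diag_mat_mult_nth algebra_simps flip: z[OF that])
  qed
  have z_step: "z (Suc t) = transpose (A' t) *v z t" if "t < T" for t
  proof -
    have "transpose (N t) *v 1 = transpose (A' t) *v (N t *v 1)"
      "transpose (M' t) *v 1 = transpose (A' t) *v (M' t *v 1)"
      using arg_cong[OF tilted[OF assms(13) that], of "\<lambda>X. transpose X *v 1"]
        arg_cong[OF tilted[OF assms(6) that], of "\<lambda>X. transpose X *v 1"]
      by (simp_all only: transpose_diag_mat_mult_vec)
    then show ?thesis
      using marginal that by (simp add: z_def matrix_vector_mult_diff_distrib)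
  qed
  have Cz: "C *v z t = 0" if "t \<le> T" for t
    using marginal that by (simp add: z_def matrix_vector_mult_diff_distrib)
  have "observability_block A C t *v z 0 = 0" if "t \<le> T" for t
  proof -
    have "u r * z r = z r" if "r < T" for r
      using Cz[of r] that assms(8)[of r] selection_mat_kernel_scaling[of p "z r" lam r] by (simp add: assms(4))
    then have "transposed_chain A t *v z 0 = div_vec (z t) (w t)"
      using that z_step w_nonzero assms(9,12) by (intro transposed_chain_tilted[where u = u and T = T]) auto
    \<comment> \<open>Selection acts coordinatewise, so dividing by \<open>w t\<close> preserves its
      kernel.\<close>
    moreover have "C *v div_vec (z t) (w t) = 0"
      using Cz[OF that] by (simp add: assms(4) vec_eq_iff selection_mat_mult_nth div_vec_def)
    ultimately show ?thesis
      by (simp add: observability_block_def flip: matrix_vector_mul_assoc)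
  qed
  moreover have "M' 0 *v 1 + z 0 \<ge> 0"
  proof -
    have "M' 0 *v 1 + z 0 = N 0 *v 1"
      using z[of 0] assms(1) by (simp add: algebra_simps)
    moreover have "nonneg_mat (N 0)"
      using feas(1) assms(1) by (simp add: primal_feasible_def)
    ultimately show ?thesis
      by (auto simp: less_eq_vec_def matrix_vector_mult_nth nonneg_mat_def intro!: sum_nonneg)
  qed
  ultimately show ?thesis
    using N_eq z_step by (intro exI[of _ z]) (auto simp: observability_kernel_def)
qed

end
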